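(* Let $k<0$ or $0<k<1$. Let $f(t,x,v)$ be a dissipative solution, of class $C_0^1$, of the Fokker-Planck equation $$\frac{\partial f}{\partial t}=\Delta_v f-v\cdot\nabla_x f+\mathrm{div}_v\big(vf(1+kf)\big),\qquad x\in\Omega,\ v\in\mathbb{R}^n,$$ satisfying $f>0$ and $1+kf>0$, and assume that $U(f,\Omega)\le 0$ for all $t$. Then $$\frac{\partial \widetilde G(f)}{\partial t}\le 0\quad\text{for all } t.$$
   Context: $\Omega\subset\mathbb{R}^n$ ($n\ge1$) is a bounded domain with boundary $\partial\Omega$ regular enough for the Gauss-Ostrogradsky formula, and $t$ ranges over the time interval in $\mathbb{R}$ on which $f$ is defined. For $k\ne0$ put $\Phi(f)=f\log f-\frac1k(1+kf)\log(1+kf)+f$ (with $0\log 0=0$). Entropy: $S(f)(t)=-\int_\Omega\int_{\mathbb{R}^n}\Phi(f)\,dv\,dx$. Total energy: $E(f)(t)=\int_\Omega\int_{\mathbb{R}^n}\frac{|v|^2}{2}f\,dv\,dx$. Free energy functional: $F(f)=S(f)-E(f)$, i.e. $F(f)=\int_\Omega\int_{\mathbb{R}^n}\big(-\frac{|v|^2}{2}f-\Phi(f)\big)dv\,dx$. $\widetilde C=\sup F(g)$, where the supremum is over functions $g$ on $\Omega\times\mathbb{R}^n$ with $g\ge0$, $1+kg>0$ and $\frac12\int_{\mathbb{R}^n}|v|^2g\,dv<\infty$; this supremum is finite for $k<0$ and for $0<k<1$. The Lyapunov functional is $\widetilde G(f)=\widetilde C-F(f)$, a function of $t$ when evaluated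 on a solution. Energy flux: $A(f,\Omega)=\int_\Omega\int_{\mathbb{R}^n}\frac{|v|^2}{2}\,v\cdot\nabla_x f\,dv\,dx$. A solution $f$ is dissipative if $A(f,\Omega)\ge0$ for all $t$. Entropy flow: $U(f,\Omega)=-\int_\Omega\int_{\mathbb{R}^n}\big(\log\frac{f}{1+kf}+1\big)v\cdot\nabla_x f\,dv\,dx=-\int_\Omega\int_{\mathbb{R}^n}v\cdot\nabla_x\Phi(f)\,dv\,dx$. $C_0^1$ is the class of differentiable functions of $(x,v)$ tending to zero sufficiently rapidly as $v\to\infty$. As a standing assumption, $f$ is regular enough for the equation to make sense, and $f$ and $\partial f/\partial v_i$ decay so that all integrals above converge, $E$ and $S$ may be differentiated in $t$ under the integral sign, and the integration by parts in $v$ arising when the equation is multiplied by $\log\frac{f}{1+kf}+1+\frac{|v|^2}{2}$ and integrated over $\mathbb{R}^n\times\Omega$ produces no terms at infinity. *)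

theory Defs
  imports "HOL-Analysis.Analysis"
begin

section \<open>Vector calculus\<close>

definition partial :: "'a::euclidean_space \<Rightarrow> ('a \<Rightarrow> real) \<Rightarrow> 'a \<Rightarrow> real" where
  "partial b h x = deriv (\<lambda>s. h (x + s *\<^sub>R b)) 0"

definition grad :: "('a::euclidean_space \<Rightarrow> real) \<Rightarrow> 'a \<Rightarrow> 'a" where
  "grad h x = (\<Sum>b\<in>Basis. partial b h x *\<^sub>R b)"

definition divergence :: "('a::euclidean_space \<Rightarrow> 'a) \<Rightarrow> 'a \<Rightarrow> real" where
  "divergence w x = (\<Sum>b\<in>Basis. partial b (\<lambda>y. w y \<bullet> b) x)"

definition laplacian :: "('a::euclidean_space \<Rightarrow> real) \<Rightarrow> 'a \<Rightarrow> real" where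
  "laplacian h x = (\<Sum>b\<in>Basis. partial b (partial b h) x)"

text \<open>The derivative within the time interval is one-sided at an end point belonging to it.\<close>

definition time_deriv ::
  "real set \<Rightarrow> (real \<Rightarrow> 'a \<Rightarrow> 'a \<Rightarrow> real) \<Rightarrow> real \<Rightarrow> 'a \<Rightarrow> 'a \<Rightarrow> real" where
  "time_deriv T f t x v = vector_derivative (\<lambda>s. f s x v) (at t within T)"

text \<open>The boundary carries a finite measure \<open>\<sigma>\<close> and a unit normal field \<open>\<nu>\<close> for which the
  Gauss--Ostrogradsky formula holds for all \<open>C\<^sup>1\<close> vector fields. The formula itself makes
  \<open>\<nu>\<close> the outward normal and \<open>\<sigma>\<close> the surface measure (for \<open>n = 1\<close>, counting measure).\<close>

definition gauss_ostrogradsky :: "'a::euclidean_space set \<Rightarrow> bool" where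
  "gauss_ostrogradsky \<Omega> \<longleftrightarrow>
    (\<exists>(\<sigma> :: 'a measure) (\<nu> :: 'a \<Rightarrow> 'a).
       finite_measure \<sigma> \<and> sets \<sigma> = sets borel \<and> emeasure \<sigma> (- frontier \<Omega>) = 0 \<and>
       \<nu> \<in> borel_measurable borel \<and> (\<forall>x\<in>frontier \<Omega>. norm (\<nu> x) = 1) \<and>
       (\<forall>(w :: 'a \<Rightarrow> 'a) (w' :: 'a \<Rightarrow> 'a \<Rightarrow>\<^sub>L 'a).
          (\<forall>x. (w has_derivative blinfun_apply (w' x)) (at x)) \<and> continuous_on UNIV w' \<longrightarrow>
          (LINT x:\<Omega>|lborel. divergence w x) = (LINT x|\<sigma>. w x \<bullet> \<nu> x)))"

section \<open>Integrals over phase space\<close>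

definition phase_int :: "'a::euclidean_space set \<Rightarrow> ('a \<Rightarrow> 'a \<Rightarrow> real) \<Rightarrow> real" where
  "phase_int \<Omega> h = (LINT x:\<Omega>|lborel. LINT v|lborel. h x v)"

definition phase_integrable :: "'a::euclidean_space set \<Rightarrow> ('a \<Rightarrow> 'a \<Rightarrow> real) \<Rightarrow> bool" where
  "phase_integrable \<Omega> h \<longleftrightarrow> set_integrable lborel (\<Omega> \<times> UNIV) (\<lambda>(x, v). h x v)"

section \<open>Entropy, energy, free energy and their fluxes\<close>

text \<open>The convention \<open>0 log 0 = 0\<close> holds because \<open>ln 0 = 0\<close> in the library.\<close>

definition Phi :: "real \<Rightarrow> real \<Rightarrow> real" where
  "Phi k z = z * ln z - 1 / k * (1 + k * z) * ln (1 + k * z) + z"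

definition entropy :: "real \<Rightarrow> 'a::euclidean_space set \<Rightarrow> ('a \<Rightarrow> 'a \<Rightarrow> real) \<Rightarrow> real" where
  "entropy k \<Omega> g = - phase_int \<Omega> (\<lambda>x v. Phi k (g x v))"

definition energy :: "'a::euclidean_space set \<Rightarrow> ('a \<Rightarrow> 'a \<Rightarrow> real) \<Rightarrow> real" where
  "energy \<Omega> g = phase_int \<Omega> (\<lambda>x v. (norm v)\<^sup>2 / 2 * g x v)"

definition free_energy_density :: "real \<Rightarrow> ('a::euclidean_space \<Rightarrow> 'a \<Rightarrow> real) \<Rightarrow> 'a \<Rightarrow> 'a \<Rightarrow> real" where
  "free_energy_density k g x v = - ((norm v)\<^sup>2 / 2) * g x v - Phi k (g x v)"

definition free_energy :: "real \<Rightarrow> 'a::euclidean_space set \<Rightarrow> ('a \<Rightarrow> 'a \<Rightarrow> real) \<Rightarrow> real" where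
  "free_energy k \<Omega> g = phase_int \<Omega> (free_energy_density k g)"

text \<open>The functions over which the supremum of the free energy is taken. The last condition says
  that the free energy of \<open>g\<close> is a convergent integral. Since the positive part of the
  density is dominated by an integrable function of \<open>v\<close> (its pointwise maximum, attained at
  \<open>g = 1 / (exp (1 + (norm v)\<^sup>2 / 2) - k)\<close>), the condition only excludes functions of free energy
  \<open>-\<infinity>\<close>, to which the Bochner integral would assign the value \<open>0\<close>.\<close>

definition admissible :: "real \<Rightarrow> 'a::euclidean_space set \<Rightarrow> ('a \<Rightarrow> 'a \<Rightarrow> real) set" where
  "admissible k \<Omega> =
    {g. set_borel_measurable lborel (\<Omega> \<times> UNIV) (\<lambda>(x, v). g x v) \<and>
        (\<forall>x\<in>\<Omega>. \<forall>v. g x v \<ge> 0 \<and> 1 + k * g x v > 0) \<and>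
        (\<forall>x\<in>\<Omega>. integrable lborel (\<lambda>v. (norm v)\<^sup>2 * g x v)) \<and>
        phase_integrable \<Omega> (free_energy_density k g)}"

definition C_tilde :: "real \<Rightarrow> 'a::euclidean_space set \<Rightarrow> real" where
  "C_tilde k \<Omega> = (SUP g\<in>admissible k \<Omega>. free_energy k \<Omega> g)"

definition G_tilde :: "real \<Rightarrow> 'a::euclidean_space set \<Rightarrow> ('a \<Rightarrow> 'a \<Rightarrow> real) \<Rightarrow> real" where
  "G_tilde k \<Omega> g = C_tilde k \<Omega> - free_energy k \<Omega> g"

definition transport :: "('a::euclidean_space \<Rightarrow> 'a \<Rightarrow> real) \<Rightarrow> 'a \<Rightarrow> 'a \<Rightarrow> real" where
  "transport g x v = v \<bullet> grad (\<lambda>y. g y v) x"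

definition energy_flux :: "'a::euclidean_space set \<Rightarrow> ('a \<Rightarrow> 'a \<Rightarrow> real) \<Rightarrow> real" where
  "energy_flux \<Omega> g = phase_int \<Omega> (\<lambda>x v. (norm v)\<^sup>2 / 2 * transport g x v)"

definition entropy_flow :: "real \<Rightarrow> 'a::euclidean_space set \<Rightarrow> ('a \<Rightarrow> 'a \<Rightarrow> real) \<Rightarrow> real" where
  "entropy_flow k \<Omega> g =
    - phase_int \<Omega> (\<lambda>x v. (ln (g x v / (1 + k * g x v)) + 1) * transport g x v)"

section \<open>Dissipative solutions of the Fokker--Planck equation\<close>

text \<open>How rapidly the functions tend to zero is made precise by \<open>standing_assumptions\<close> below.\<close>

definition C01 :: "'a::euclidean_space set \<Rightarrow> ('a \<Rightarrow> 'a \<Rightarrow> real) \<Rightarrow> bool" where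
  "C01 \<Omega> g \<longleftrightarrow>
    (\<forall>x\<in>\<Omega>. \<forall>v. (\<lambda>(y, u). g y u) differentiable (at (x, v))) \<and>
    (\<forall>x\<in>\<Omega>. (g x \<longlongrightarrow> 0) at_infinity)"

text \<open>The first two clauses provide the derivatives in the equation not covered by \<open>C01\<close>.\<close>

definition fokker_planck_solution ::
  "real \<Rightarrow> 'a::euclidean_space set \<Rightarrow> real set \<Rightarrow> (real \<Rightarrow> 'a \<Rightarrow> 'a \<Rightarrow> real) \<Rightarrow> bool" where
  "fokker_planck_solution k \<Omega> T f \<longleftrightarrow>
    (\<forall>t\<in>T. \<forall>x\<in>\<Omega>. \<forall>v.
      (\<lambda>s. f s x v) differentiable (at t within T) \<and>
      (\<forall>b\<in>Basis. (\<lambda>s. partial b (f t x) (v + s *\<^sub>R b)) differentiable (at 0)) \<and>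
      time_deriv T f t x v =
        laplacian (f t x) v - v \<bullet> grad (\<lambda>y. f t y v) x
        + divergence (\<lambda>u. (f t x u * (1 + k * f t x u)) *\<^sub>R u) v)"

definition dissipative ::
  "'a::euclidean_space set \<Rightarrow> real set \<Rightarrow> (real \<Rightarrow> 'a \<Rightarrow> 'a \<Rightarrow> real) \<Rightarrow> bool" where
  "dissipative \<Omega> T f \<longleftrightarrow> (\<forall>t\<in>T. energy_flux \<Omega> (f t) \<ge> 0)"

section \<open>Standing regularity and decay assumptions\<close>

definition integrals_converge ::
  "real \<Rightarrow> 'a::euclidean_space set \<Rightarrow> ('a \<Rightarrow> 'a \<Rightarrow> real) \<Rightarrow> bool" where
  "integrals_converge k \<Omega> g \<longleftrightarrow>
    phase_integrable \<Omega> (\<lambda>x v. Phi k (g x v)) \<and>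
    phase_integrable \<Omega> (\<lambda>x v. (norm v)\<^sup>2 / 2 * g x v) \<and>
    phase_integrable \<Omega> (\<lambda>x v. (norm v)\<^sup>2 / 2 * transport g x v) \<and>
    phase_integrable \<Omega> (\<lambda>x v. (ln (g x v / (1 + k * g x v)) + 1) * transport g x v)"

definition differentiable_under_integral ::
  "'a::euclidean_space set \<Rightarrow> real set \<Rightarrow> (real \<Rightarrow> 'a \<Rightarrow> 'a \<Rightarrow> real) \<Rightarrow> bool" where
  "differentiable_under_integral \<Omega> T h \<longleftrightarrow>
    (\<forall>t\<in>T. phase_integrable \<Omega> (time_deriv T h t) \<and>
      ((\<lambda>s. phase_int \<Omega> (h s)) has_real_derivative phase_int \<Omega> (time_deriv T h t)) (at t within T))"

text \<open>When the integral of \<open>g * divergence J\<close> over velocities is integrated by parts in each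
  coordinate, the integrals converge and the boundary terms \<open>g * J\<^sub>b\<close> vanish at both ends of
  every line parallel to the \<open>b\<close>-axis.\<close>

definition no_terms_at_infinity ::
  "'a::euclidean_space set \<Rightarrow> ('a \<Rightarrow> 'a \<Rightarrow> real) \<Rightarrow> ('a \<Rightarrow> 'a \<Rightarrow> 'a) \<Rightarrow> bool" where
  "no_terms_at_infinity \<Omega> g J \<longleftrightarrow>
    (\<forall>b\<in>Basis.
      phase_integrable \<Omega> (\<lambda>x v. g x v * partial b (\<lambda>u. J x u \<bullet> b) v) \<and>
      (\<forall>x\<in>\<Omega>. \<forall>v. ((\<lambda>s::real. g x (v + s *\<^sub>R b) * (J x (v + s *\<^sub>R b) \<bullet> b)) \<longlongrightarrow> 0) at_infinity))"

text \<open>The right-hand side of the equation is \<open>divergence J - transport f\<close> with the velocity flux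
  \<open>J = grad f + f (1 + k f) v\<close>.\<close>

definition velocity_flux ::
  "real \<Rightarrow> ('a::euclidean_space \<Rightarrow> 'a \<Rightarrow> real) \<Rightarrow> 'a \<Rightarrow> 'a \<Rightarrow> 'a" where
  "velocity_flux k g x v = grad (g x) v + (g x v * (1 + k * g x v)) *\<^sub>R v"

definition standing_assumptions ::
  "real \<Rightarrow> 'a::euclidean_space set \<Rightarrow> real set \<Rightarrow> (real \<Rightarrow> 'a \<Rightarrow> 'a \<Rightarrow> real) \<Rightarrow> bool" where
  "standing_assumptions k \<Omega> T f \<longleftrightarrow>
    (\<forall>t\<in>T. integrals_converge k \<Omega> (f t)) \<and>
    differentiable_under_integral \<Omega> T (\<lambda>t x v. (norm v)\<^sup>2 / 2 * f t x v) \<and>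
    differentiable_under_integral \<Omega> T (\<lambda>t x v. Phi k (f t x v)) \<and>
    (\<forall>t\<in>T. no_terms_at_infinity \<Omega>
      (\<lambda>x v. ln (f t x v / (1 + k * f t x v)) + 1 + (norm v)\<^sup>2 / 2) (velocity_flux k (f t)))"

end

theory Submission
  imports Defs
begin

text \<open>Write \<open>g = ln (f / (1 + k f)) + 1 + (norm v)\<^sup>2 / 2\<close> and \<open>J = grad f + f (1 + k f) v\<close> (gradient in
  \<open>v\<close>). Up to a constant, the Lyapunov functional is the sum of the energy and of the integral of
  \<open>Phi k f\<close>; the pointwise time derivative of the sum of the two densities is \<open>g\<close> times the time
  derivative of \<open>f\<close>, that is, \<open>g * divergence J - g * transport f\<close> by the equation. Integrated over
  phase space, the transport part gives the entropy flow, \<open>\<le> 0\<close> by hypothesis, minus the energy flux,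
  \<open>\<ge> 0\<close> for a dissipative solution.

  For the remaining part, the point is that \<open>grad g = J / (f (1 + k f))\<close>. Hence for every coordinate
  direction \<open>b\<close>, with \<open>J\<^sub>b = J \<bullet> b\<close>,
  \<open>\<partial>\<^sub>b (g J\<^sub>b) = g \<partial>\<^sub>b J\<^sub>b + J\<^sub>b\<^sup>2 / (f (1 + k f)) \<ge> g \<partial>\<^sub>b J\<^sub>b\<close>.
  As \<open>g J\<^sub>b\<close> vanishes at both ends of every line parallel to \<open>b\<close>, the integral of \<open>g \<partial>\<^sub>b J\<^sub>b\<close> along each
  such line is \<open>\<le> 0\<close> (\<open>integral_nonpos_of_le_deriv\<close>), and by Fubini's theorem so is its integral over
  velocity space (\<open>lborel_integral_nonpos_of_lines\<close>). Only the inequality is used, so the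
  integrability of the dissipation \<open>J\<^sub>b\<^sup>2 / (f (1 + k f))\<close> is not needed.\<close>

section \<open>Integrals along lines\<close>

text \<open>No integrability of \<open>h\<close> is needed, since otherwise its integral is \<open>0\<close>.\<close>

lemma integral_nonpos_of_le_deriv:
  fixes p p' h :: "real \<Rightarrow> real"
  assumes deriv: "\<And>s. (p has_real_derivative p' s) (at s)"
    and le: "\<And>s. h s \<le> p' s"
    and lim: "(p \<longlongrightarrow> 0) at_infinity"
  shows "(LINT s|lborel. h s) \<le> 0"
proof (cases "integrable lborel h")
  case int: True
  define H where "H n = (LINT s|lborel. indicator {- real n..real n} s *\<^sub>R h s)" for n :: nat
  have "H \<longlonglongrightarrow> (LINT s|lborel. h s)"
    unfolding H_def
  proof (rule integral_dominated_convergence[where w = "\<lambda>s. \<bar>h s\<bar>"])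
    show "AE s in lborel. (\<lambda>n. indicator {- real n..real n} s *\<^sub>R h s) \<longlonglongrightarrow> h s"
    proof (rule AE_I2, rule tendsto_eventually)
      fix s :: real
      obtain N :: nat where N: "\<bar>s\<bar> \<le> real N"
        using real_arch_simple by blast
      show "\<forall>\<^sub>F n in sequentially. indicator {- real n..real n} s *\<^sub>R h s = h s"
        using eventually_ge_at_top[of N]
      proof eventually_elim
        case (elim n)
        then have "real N \<le> real n" by simp
        with N show ?case by (auto simp: indicator_def abs_le_iff)
      qed
    qed
  qed (use int in \<open>auto simp: indicator_def\<close>)
  moreover have "(\<lambda>n. p (real n) - p (- real n)) \<longlonglongrightarrow> 0 - 0"
  proof (intro tendsto_diff)
    have n: "filterlim real at_infinity sequentially"
      by (rule filterlim_at_top_imp_at_infinity[OF filterlim_real_sequentially])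
    then show "(\<lambda>n. p (real n)) \<longlonglongrightarrow> 0"
      by (rule filterlim_compose[OF lim])
    have "filterlim (\<lambda>n. - real n) at_infinity sequentially"
      using n by (simp add: filterlim_at_infinity_conv_norm_at_top)
    then show "(\<lambda>n. p (- real n)) \<longlonglongrightarrow> 0"
      by (rule filterlim_compose[OF lim])
  qed
  moreover have "H n \<le> p (real n) - p (- real n)" for n
  proof -
    have set_int: "set_integrable lborel {- real n..real n} h"
      using integrable_mult_indicator[OF _ int, of "{- real n..real n}"]
      by (simp add: set_integrable_def)
    have "(h has_integral H n) {- real n..real n}"
      using has_integral_set_lebesgue[of "{- real n..real n}" h] set_borel_integral_eq_integral[OF set_int]
      by (simp add: H_def set_lebesgue_integral_def has_integral_integral)
    moreover have "(p' has_integral (p (real n) - p (- real n))) {- real n..real n}"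
      by (rule fundamental_theorem_of_calculus)
        (use deriv in \<open>auto simp: has_real_derivative_iff_has_vector_derivative
          intro: has_vector_derivative_at_within\<close>)
    ultimately show ?thesis
      by (rule has_integral_le) (rule le)
  qed
  ultimately have "(LINT s|lborel. h s) \<le> 0 - 0"
    by (intro LIMSEQ_le) auto
  then show ?thesis by simp
qed (simp add: not_integrable_integral_eq)

text \<open>Lebesgue measure is the product of the Lebesgue measures of the coordinates, so the \<open>b\<close>-coordinate
  can be integrated out first. The inner integral has the sign for every line, whether or not \<open>h\<close> is
  integrable along it.\<close>

lemma lborel_integral_nonpos_of_lines:
  fixes h :: "'a::euclidean_space \<Rightarrow> real"
  assumes b: "b \<in> Basis"
    and lines: "\<And>v. (LINT s|lborel. h (v + s *\<^sub>R b)) \<le> 0"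
  shows "(LINT v|lborel. h v) \<le> 0"
proof (cases "integrable lborel h")
  case int: True
  interpret product_sigma_finite "\<lambda>_::'a. lborel :: real measure" ..
  let ?e = "\<lambda>y. \<Sum>c\<in>Basis. y c *\<^sub>R c :: 'a"
  let ?P = "\<lambda>I. \<Pi>\<^sub>M c\<in>I. (lborel :: real measure)"
  have basis: "insert b (Basis - {b}) = Basis"
    using b by auto
  have e: "?e \<in> measurable (?P Basis) borel"
    by measurable
  have h: "h \<in> borel_measurable borel"
    using borel_measurable_integrable[OF int] by simp
  have "integrable (distr (?P Basis) borel ?e) h"
    using int lborel_eq[where 'a = 'a] by simp
  then have int': "integrable (?P (insert b (Basis - {b}))) (\<lambda>y. h (?e y))"
    using integrable_distr_eq[OF e h] basis by simp
  have "(LINT v|lborel. h v) = (LINT y|?P Basis. h (?e y))"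
    by (subst lborel_eq) (rule integral_distr[OF e h])
  also have "\<dots> = (LINT y|?P (Basis - {b}). LINT s|lborel. h (?e (y(b := s))))"
    using product_integral_insert[OF _ _ int'] basis by simp
  also have "\<dots> = (LINT y|?P (Basis - {b}). LINT s|lborel. h ((\<Sum>c\<in>Basis - {b}. y c *\<^sub>R c) + s *\<^sub>R b))"
  proof -
    have "?e (y(b := s)) = (\<Sum>c\<in>Basis - {b}. y c *\<^sub>R c) + s *\<^sub>R b" for y s
      by (subst sum.remove[OF _ b]) (auto simp: add.commute intro!: sum.cong)
    then show ?thesis by simp
  qed
  also have "\<dots> = - (LINT y|?P (Basis - {b}). - (LINT s|lborel. h ((\<Sum>c\<in>Basis - {b}. y c *\<^sub>R c) + s *\<^sub>R b)))"
    by simp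
  also have "\<dots> \<le> 0"
    unfolding neg_le_0_iff_le by (rule Bochner_Integration.integral_nonneg) (simp add: lines)
  finally show ?thesis .
qed (simp add: not_integrable_integral_eq)

section \<open>Phase space integrals\<close>

text \<open>Fubini's theorem turns the iterated integral into an integral over the product, and with it
  gives the linearity of \<^const>\<open>phase_int\<close>.\<close>

lemma phase_int_eq_lborel:
  assumes "phase_integrable \<Omega> h"
  shows "phase_int \<Omega> h = (LINT p:\<Omega> \<times> UNIV|lborel. case p of (x, v) \<Rightarrow> h x v)"
proof -
  have ind: "indicator (\<Omega> \<times> UNIV) (x, v) = (indicator \<Omega> x :: real)" for x v :: 'a
    by (simp add: indicator_def)
  have "integrable (lborel \<Otimes>\<^sub>M lborel) (\<lambda>p. indicator (\<Omega> \<times> UNIV) p *\<^sub>R (case p of (x, v) \<Rightarrow> h x v))"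
    using assms unfolding phase_integrable_def set_integrable_def lborel_prod .
  from lborel_pair.integral_fst'[OF this] show ?thesis
    by (simp add: phase_int_def set_lebesgue_integral_def lborel_prod ind)
qed

lemma phase_int_cong:
  assumes "\<And>x v. x \<in> \<Omega> \<Longrightarrow> h1 x v = h2 x v"
  shows "phase_int \<Omega> h1 = phase_int \<Omega> h2"
  unfolding phase_int_def set_lebesgue_integral_def
  by (rule Bochner_Integration.integral_cong)
    (auto simp: indicator_def assms cong: Bochner_Integration.integral_cong)

lemma phase_integrable_add:
  assumes "phase_integrable \<Omega> h1" "phase_integrable \<Omega> h2"
  shows "phase_integrable \<Omega> (\<lambda>x v. h1 x v + h2 x v)"
  using set_integral_add(1)[OF assms[unfolded phase_integrable_def]]
  by (simp add: phase_integrable_def case_prod_unfold)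

lemma phase_int_add:
  assumes "phase_integrable \<Omega> h1" "phase_integrable \<Omega> h2"
  shows "phase_int \<Omega> (\<lambda>x v. h1 x v + h2 x v) = phase_int \<Omega> h1 + phase_int \<Omega> h2"
  using set_integral_add(2)[OF assms[unfolded phase_integrable_def]]
  by (simp add: phase_int_eq_lborel[OF phase_integrable_add[OF assms]]
      phase_int_eq_lborel[OF assms(1)] phase_int_eq_lborel[OF assms(2)] case_prod_unfold)

lemma phase_integrable_uminus:
  assumes "phase_integrable \<Omega> h"
  shows "phase_integrable \<Omega> (\<lambda>x v. - h x v)"
  using assms by (simp add: phase_integrable_def set_integrable_def case_prod_unfold)

lemma phase_int_uminus: "phase_int \<Omega> (\<lambda>x v. - h x v) = - phase_int \<Omega> h"
  by (simp add: phase_int_def set_lebesgue_integral_def)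

lemma phase_integral_sum:
  assumes "finite I" "\<And>i. i \<in> I \<Longrightarrow> phase_integrable \<Omega> (h i)"
  shows "phase_integrable \<Omega> (\<lambda>x v. \<Sum>i\<in>I. h i x v) \<and>
    phase_int \<Omega> (\<lambda>x v. \<Sum>i\<in>I. h i x v) = (\<Sum>i\<in>I. phase_int \<Omega> (h i))"
  using assms
proof (induction I rule: finite_induct)
  case empty
  then show ?case
    by (simp add: phase_integrable_def phase_int_def set_integrable_def set_lebesgue_integral_def case_prod_unfold)
next
  case (insert i I)
  then show ?case
    using phase_integrable_add[of \<Omega> "h i" "\<lambda>x v. \<Sum>i\<in>I. h i x v"]
      phase_int_add[of \<Omega> "h i" "\<lambda>x v. \<Sum>i\<in>I. h i x v"] by simp
qed

lemma phase_int_nonpos: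
  assumes "\<And>x. x \<in> \<Omega> \<Longrightarrow> (LINT v|lborel. h x v) \<le> 0"
  shows "phase_int \<Omega> h \<le> 0"
proof -
  have "0 \<le> (LINT x|lborel. indicator \<Omega> x *\<^sub>R - (LINT v|lborel. h x v))"
    by (rule Bochner_Integration.integral_nonneg) (auto simp: indicator_def assms)
  then show ?thesis
    by (simp add: phase_int_def set_lebesgue_integral_def)
qed

section \<open>The entropy density and the velocity flux\<close>

lemma Phi_has_real_derivative:
  assumes "k \<noteq> 0" "0 < z" "0 < 1 + k * z"
  shows "(Phi k has_real_derivative ln (z / (1 + k * z)) + 1) (at z)"
proof -
  define L where "L y = (1 + k * y) * ln (1 + k * y)" for y
  have L: "(L has_real_derivative k * ln (1 + k * z) + k) (at z)"
    unfolding L_def[abs_def] using assms by (auto intro!: derivative_eq_intros)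
  have "((\<lambda>y. y * ln y - 1 / k * L y + y) has_real_derivative
      ln z - ln (1 + k * z) + 1) (at z)"
    using assms by (auto intro!: derivative_eq_intros L simp: add_divide_distrib)
  then show ?thesis
    using assms by (simp add: Phi_def[abs_def] L_def ln_div mult.assoc)
qed

lemma ln_quotient_has_real_derivative:
  fixes k z :: real
  assumes "0 < z" "0 < 1 + k * z"
  shows "((\<lambda>y. ln (y / (1 + k * y))) has_real_derivative 1 / (z * (1 + k * z))) (at z)"
proof -
  have "((\<lambda>y. y / (1 + k * y)) has_real_derivative 1 / (1 + k * z)\<^sup>2) (at z)"
    using assms by (auto intro!: derivative_eq_intros simp: power2_eq_square algebra_simps)
  moreover have "(ln has_real_derivative (1 + k * z) / z) (at (z / (1 + k * z)))"
    using assms by (auto intro!: derivative_eq_intros)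
  ultimately have "((\<lambda>y. ln (y / (1 + k * y))) has_real_derivative
      (1 + k * z) / z * (1 / (1 + k * z)\<^sup>2)) (at z)"
    by (rule DERIV_chain2[rotated])
  then show ?thesis
    using assms by (simp add: power2_eq_square)
qed

lemma partial_along_line:
  assumes "\<And>v. (\<lambda>s. h (v + s *\<^sub>R b)) differentiable at 0"
  shows "((\<lambda>s. h (v + s *\<^sub>R b)) has_real_derivative partial b h (v + s *\<^sub>R b)) (at s)"
proof -
  have "((\<lambda>r. h (v + s *\<^sub>R b + r *\<^sub>R b)) has_real_derivative partial b h (v + s *\<^sub>R b)) (at 0)"
    unfolding partial_def using assms[of "v + s *\<^sub>R b"]
    by (simp add: DERIV_deriv_iff_real_differentiable)
  then have "((\<lambda>r. h (v + (r + s) *\<^sub>R b)) has_real_derivative partial b h (v + s *\<^sub>R b)) (at 0)"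
    by (simp add: algebra_simps)
  then show ?thesis
    using DERIV_shift[of "\<lambda>s. h (v + s *\<^sub>R b)" "partial b h (v + s *\<^sub>R b)" 0 s] by simp
qed

lemma partial_add:
  assumes "(\<lambda>s. h1 (v + s *\<^sub>R b)) differentiable at 0" "(\<lambda>s. h2 (v + s *\<^sub>R b)) differentiable at 0"
  shows "partial b (\<lambda>u. h1 u + h2 u) v = partial b h1 v + partial b h2 v"
  unfolding partial_def
  by (rule DERIV_imp_deriv, rule DERIV_add)
    (use assms in \<open>simp_all add: DERIV_deriv_iff_real_differentiable\<close>)

lemma grad_inner_Basis: "b \<in> Basis \<Longrightarrow> grad h x \<bullet> b = partial b h x"
  by (simp add: grad_def inner_sum_left inner_Basis if_distrib sum.delta cong: if_cong)

lemma velocity_flux_inner_Basis: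
  "b \<in> Basis \<Longrightarrow>
    velocity_flux k g x v \<bullet> b = partial b (g x) v + g x v * (1 + k * g x v) * (v \<bullet> b)"
  by (simp add: velocity_flux_def inner_add_left grad_inner_Basis)

lemma inner_line_differentiable: "(\<lambda>s. (v + s *\<^sub>R b) \<bullet> c) differentiable at (s::real)"
  by (simp add: inner_add_left)

lemma sum_partial_velocity_flux:
  fixes g :: "'a::euclidean_space \<Rightarrow> 'a \<Rightarrow> real"
  assumes diff: "\<And>b. b \<in> Basis \<Longrightarrow> (\<lambda>s. g x (v + s *\<^sub>R b)) differentiable at 0"
    and diff2: "\<And>b. b \<in> Basis \<Longrightarrow> (\<lambda>s. partial b (g x) (v + s *\<^sub>R b)) differentiable at 0"
  shows "(\<Sum>b\<in>Basis. partial b (\<lambda>u. velocity_flux k g x u \<bullet> b) v) =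
    laplacian (g x) v + divergence (\<lambda>u. (g x u * (1 + k * g x u)) *\<^sub>R u) v"
  unfolding laplacian_def divergence_def sum.distrib[symmetric]
proof (rule sum.cong)
  fix b :: 'a
  assume b: "b \<in> Basis"
  have "(\<lambda>s. g x (v + s *\<^sub>R b) * (1 + k * g x (v + s *\<^sub>R b)) * ((v + s *\<^sub>R b) \<bullet> b)) differentiable at 0"
    by (intro differentiable_mult differentiable_add differentiable_const diff[OF b] inner_line_differentiable)
  then show "partial b (\<lambda>u. velocity_flux k g x u \<bullet> b) v = partial b (partial b (g x)) v +
      partial b (\<lambda>u. (g x u * (1 + k * g x u)) *\<^sub>R u \<bullet> b) v"
    using diff2[OF b] by (simp add: velocity_flux_inner_Basis[OF b] partial_add)
qed simp

text \<open>The sign of the dissipation in one coordinate direction. With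
  \<open>g = ln (f / (1 + k f)) + 1 + (norm v)\<^sup>2 / 2\<close>, the derivative of \<open>g\<close> in direction \<open>b\<close> is
  \<open>J\<^sub>b / (f (1 + k f))\<close>, a positive multiple of \<open>J\<^sub>b\<close>.\<close>

lemma velocity_flux_integral_nonpos:
  fixes f :: "'a::euclidean_space \<Rightarrow> 'a \<Rightarrow> real"
  assumes b: "b \<in> Basis"
    and pos: "\<And>v. 0 < f x v" "\<And>v. 0 < 1 + k * f x v"
    and diff: "\<And>v. (\<lambda>s. f x (v + s *\<^sub>R b)) differentiable at 0"
    and diff2: "\<And>v. (\<lambda>s. partial b (f x) (v + s *\<^sub>R b)) differentiable at 0"
    and lim: "\<And>v. ((\<lambda>s. (ln (f x (v + s *\<^sub>R b) / (1 + k * f x (v + s *\<^sub>R b))) + 1 + (norm (v + s *\<^sub>R b))\<^sup>2 / 2)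
      * (velocity_flux k f x (v + s *\<^sub>R b) \<bullet> b)) \<longlongrightarrow> 0) at_infinity"
  shows "(LINT v|lborel. (ln (f x v / (1 + k * f x v)) + 1 + (norm v)\<^sup>2 / 2)
    * partial b (\<lambda>u. velocity_flux k f x u \<bullet> b) v) \<le> 0"
proof (rule lborel_integral_nonpos_of_lines[OF b])
  fix v :: 'a
  define g where "g u = ln (f x u / (1 + k * f x u)) + 1 + (norm u)\<^sup>2 / 2" for u
  define J where "J u = velocity_flux k f x u \<bullet> b" for u
  have J_eq: "J u = partial b (f x) u + f x u * (1 + k * f x u) * (u \<bullet> b)" for u
    by (simp add: J_def velocity_flux_inner_Basis[OF b])
  have "(\<lambda>s. J (u + s *\<^sub>R b)) differentiable at 0" for u
    unfolding J_eq
    by (intro differentiable_mult differentiable_add differentiable_const diff diff2 inner_line_differentiable)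
  then have J': "((\<lambda>s. J (v + s *\<^sub>R b)) has_real_derivative partial b J (v + s *\<^sub>R b)) (at s)" for s
    by (rule partial_along_line)
  have g': "((\<lambda>s. g (v + s *\<^sub>R b)) has_real_derivative
      J (v + s *\<^sub>R b) / (f x (v + s *\<^sub>R b) * (1 + k * f x (v + s *\<^sub>R b)))) (at s)" for s
  proof -
    let ?w = "v + s *\<^sub>R b"
    have "((\<lambda>s. ln (f x (v + s *\<^sub>R b) / (1 + k * f x (v + s *\<^sub>R b)))) has_real_derivative
        1 / (f x ?w * (1 + k * f x ?w)) * partial b (f x) ?w) (at s)"
      by (rule DERIV_chain2[OF ln_quotient_has_real_derivative partial_along_line[OF diff]])
        (rule pos)+
    moreover have "((\<lambda>s. (norm (v + s *\<^sub>R b))\<^sup>2 / 2) has_real_derivative ?w \<bullet> b) (at s)"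
    proof -
      have "((\<lambda>s. ((v \<bullet> v) + 2 * s * (v \<bullet> b) + s\<^sup>2) / 2) has_real_derivative ?w \<bullet> b) (at s)"
        using b by (auto intro!: derivative_eq_intros simp: inner_add_left)
      moreover have "(norm (v + s *\<^sub>R b))\<^sup>2 = (v \<bullet> v) + 2 * s * (v \<bullet> b) + s\<^sup>2" for s
        unfolding power2_norm_eq_inner using b
        by (simp add: inner_add_left inner_add_right inner_commute[of b v] power2_eq_square distrib_left)
      ultimately show ?thesis by simp
    qed
    ultimately have "((\<lambda>s. g (v + s *\<^sub>R b)) has_real_derivative
        1 / (f x ?w * (1 + k * f x ?w)) * partial b (f x) ?w + 0 + ?w \<bullet> b) (at s)"
      unfolding g_def by (intro DERIV_add DERIV_const)
    moreover have "f x ?w \<noteq> 0" "1 + k * f x ?w \<noteq> 0"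
      using pos[of ?w] by auto
    then have "1 / (f x ?w * (1 + k * f x ?w)) * partial b (f x) ?w + 0 + ?w \<bullet> b
        = J ?w / (f x ?w * (1 + k * f x ?w))"
      unfolding J_eq by (simp add: add_divide_distrib)
    ultimately show ?thesis by simp
  qed
  have "(LINT s|lborel. g (v + s *\<^sub>R b) * partial b J (v + s *\<^sub>R b)) \<le> 0"
  proof (rule integral_nonpos_of_le_deriv)
    fix s :: real
    let ?w = "v + s *\<^sub>R b"
    show "((\<lambda>s. g (v + s *\<^sub>R b) * J (v + s *\<^sub>R b)) has_real_derivative
        J ?w / (f x ?w * (1 + k * f x ?w)) * J ?w + partial b J ?w * g ?w) (at s)"
      by (rule DERIV_mult[OF g' J'])
    have "0 \<le> J ?w * J ?w / (f x ?w * (1 + k * f x ?w))"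
      using pos[of ?w] by (intro divide_nonneg_pos mult_pos_pos) auto
    then show "g ?w * partial b J ?w \<le>
        J ?w / (f x ?w * (1 + k * f x ?w)) * J ?w + partial b J ?w * g ?w"
      by (simp add: mult.commute)
  qed (use lim in \<open>simp add: g_def J_def\<close>)
  then show "(LINT s|lborel. (ln (f x (v + s *\<^sub>R b) / (1 + k * f x (v + s *\<^sub>R b))) + 1
      + (norm (v + s *\<^sub>R b))\<^sup>2 / 2) * partial b (\<lambda>u. velocity_flux k f x u \<bullet> b) (v + s *\<^sub>R b)) \<le> 0"
    by (simp add: g_def J_def[abs_def])
qed

section \<open>Decay of the Lyapunov functional\<close>

lemma time_deriv_eqI:
  assumes "at t within T \<noteq> bot" "((\<lambda>s. h s x v) has_real_derivative d) (at t within T)"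
  shows "time_deriv T h t x v = d"
  unfolding time_deriv_def using assms
  by (intro vector_derivative_within) (simp_all add: has_real_derivative_iff_has_vector_derivative)

lemma free_energy_eq:
  assumes "integrals_converge k \<Omega> g"
  shows "free_energy k \<Omega> g =
    - phase_int \<Omega> (\<lambda>x v. (norm v)\<^sup>2 / 2 * g x v) - phase_int \<Omega> (\<lambda>x v. Phi k (g x v))"
proof -
  let ?E = "\<lambda>x v. (norm v)\<^sup>2 / 2 * g x v" and ?P = "\<lambda>x v. Phi k (g x v)"
  have "phase_int \<Omega> (\<lambda>x v. - ?E x v + - ?P x v) = - phase_int \<Omega> ?E - phase_int \<Omega> ?P"
    using assms unfolding integrals_converge_def
    by (subst phase_int_add) (simp_all add: phase_integrable_uminus phase_int_uminus)
  then show ?thesis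
    by (simp add: free_energy_def free_energy_density_def[abs_def])
qed

text \<open>The derivative of the Lyapunov functional splits into the dissipation in each coordinate
  direction of the velocity, the energy flux and the entropy flow.\<close>

lemma lyapunov_time_deriv_eq:
  fixes f :: "real \<Rightarrow> 'a::euclidean_space \<Rightarrow> 'a \<Rightarrow> real"
  assumes "k \<noteq> 0" and t: "t \<in> T" and nontriv: "at t within T \<noteq> bot"
    and pos: "\<And>x v. x \<in> \<Omega> \<Longrightarrow> 0 < f t x v \<and> 0 < 1 + k * f t x v"
    and diff: "\<And>x v b. x \<in> \<Omega> \<Longrightarrow> b \<in> Basis \<Longrightarrow> (\<lambda>s. f t x (v + s *\<^sub>R b)) differentiable at 0"
    and sol: "fokker_planck_solution k \<Omega> T f"
    and std: "standing_assumptions k \<Omega> T f"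
  shows "phase_int \<Omega> (time_deriv T (\<lambda>t x v. (norm v)\<^sup>2 / 2 * f t x v) t)
      + phase_int \<Omega> (time_deriv T (\<lambda>t x v. Phi k (f t x v)) t)
    = (\<Sum>b\<in>Basis. phase_int \<Omega> (\<lambda>x v. (ln (f t x v / (1 + k * f t x v)) + 1 + (norm v)\<^sup>2 / 2)
        * partial b (\<lambda>u. velocity_flux k (f t) x u \<bullet> b) v))
      - energy_flux \<Omega> (f t) + entropy_flow k \<Omega> (f t)"
proof -
  define l where "l x v = ln (f t x v / (1 + k * f t x v)) + 1" for x v
  define d where "d b x v = (l x v + (norm v)\<^sup>2 / 2) * partial b (\<lambda>u. velocity_flux k (f t) x u \<bullet> b) v" for b x v
  let ?E = "time_deriv T (\<lambda>t x v. (norm v)\<^sup>2 / 2 * f t x v) t"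
  let ?P = "time_deriv T (\<lambda>t x v. Phi k (f t x v)) t"
  let ?A = "\<lambda>x v. (norm v)\<^sup>2 / 2 * transport (f t) x v" and ?U = "\<lambda>x v. l x v * transport (f t) x v"
  have int: "phase_integrable \<Omega> ?E" "phase_integrable \<Omega> ?P"
    "phase_integrable \<Omega> ?A" "phase_integrable \<Omega> ?U"
    "\<And>b. b \<in> Basis \<Longrightarrow> phase_integrable \<Omega> (d b)"
    using std t by (simp_all add: standing_assumptions_def differentiable_under_integral_def
        integrals_converge_def no_terms_at_infinity_def l_def[abs_def] d_def[abs_def])
  have density: "?E x v + ?P x v = (\<Sum>b\<in>Basis. d b x v) + (- ?A x v + - ?U x v)" if x: "x \<in> \<Omega>" for x v
  proof -
    let ?f' = "time_deriv T f t x v"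
    have "(\<lambda>s. f s x v) differentiable (at t within T)"
      using sol t x by (auto simp: fokker_planck_solution_def)
    then have f': "((\<lambda>s. f s x v) has_real_derivative ?f') (at t within T)"
      by (simp add: time_deriv_def has_real_derivative_iff_has_vector_derivative vector_derivative_works)
    have diff2: "(\<lambda>s. partial b (f t x) (v + s *\<^sub>R b)) differentiable at 0" if "b \<in> Basis" for b
      using sol t x that by (auto simp: fokker_planck_solution_def)
    have "?E x v = (norm v)\<^sup>2 / 2 * ?f'"
      by (rule time_deriv_eqI[OF nontriv], rule DERIV_cmult[OF f'])
    moreover have "?P x v = l x v * ?f'"
      unfolding l_def
      by (rule time_deriv_eqI[OF nontriv], rule DERIV_chain2[OF Phi_has_real_derivative f'])
        (use assms(1) pos x in auto)
    moreover have "?f' = (\<Sum>b\<in>Basis. partial b (\<lambda>u. velocity_flux k (f t) x u \<bullet> b) v) - transport (f t) x v"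
      using sol t x sum_partial_velocity_flux[of "f t" x v k, OF diff[OF x] diff2]
      by (simp add: fokker_planck_solution_def transport_def)
    moreover have "(\<Sum>b\<in>Basis. d b x v) =
        (l x v + (norm v)\<^sup>2 / 2) * (\<Sum>b\<in>Basis. partial b (\<lambda>u. velocity_flux k (f t) x u \<bullet> b) v)"
      by (simp add: d_def sum_distrib_left)
    ultimately have "?E x v + ?P x v = (norm v)\<^sup>2 / 2 * ?f' + l x v * ?f'"
      "(\<Sum>b\<in>Basis. d b x v) = (l x v + (norm v)\<^sup>2 / 2) * (?f' + transport (f t) x v)"
      by simp_all
    then show ?thesis
      by (simp only: distrib_left distrib_right)
  qed
  have "phase_int \<Omega> ?E + phase_int \<Omega> ?P = phase_int \<Omega> (\<lambda>x v. ?E x v + ?P x v)"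
    by (rule phase_int_add[symmetric]) (rule int)+
  also have "\<dots> = phase_int \<Omega> (\<lambda>x v. (\<Sum>b\<in>Basis. d b x v) + (- ?A x v + - ?U x v))"
    by (rule phase_int_cong) (rule density)
  also have "\<dots> = (\<Sum>b\<in>Basis. phase_int \<Omega> (d b)) + (- phase_int \<Omega> ?A + - phase_int \<Omega> ?U)"
  proof -
    have sum: "phase_integrable \<Omega> (\<lambda>x v. \<Sum>b\<in>Basis. d b x v)"
      "phase_int \<Omega> (\<lambda>x v. \<Sum>b\<in>Basis. d b x v) = (\<Sum>b\<in>Basis. phase_int \<Omega> (d b))"
      using phase_integral_sum[of Basis \<Omega> d] int(5) by auto
    note A = phase_integrable_uminus[OF int(3)] and U = phase_integrable_uminus[OF int(4)]
    show ?thesis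
      by (simp only: phase_int_add[OF sum(1) phase_integrable_add[OF A U]] phase_int_add[OF A U]
          sum(2) phase_int_uminus)
  qed
  finally show ?thesis
    by (simp add: energy_flux_def entropy_flow_def l_def d_def[abs_def])
qed

theorem theorem4p1:
  fixes k :: real
    and \<Omega> :: "'a::euclidean_space set"
    and T :: "real set"
    and f :: "real \<Rightarrow> 'a \<Rightarrow> 'a \<Rightarrow> real"
  assumes "k < 0 \<or> (0 < k \<and> k < 1)"
    and "open \<Omega>" "connected \<Omega>" "\<Omega> \<noteq> {}" "bounded \<Omega>" "gauss_ostrogradsky \<Omega>"
    and "is_interval T" "interior T \<noteq> {}"
    and "\<forall>t\<in>T. C01 \<Omega> (f t)"
    and "\<forall>t\<in>T. \<forall>x\<in>\<Omega>. \<forall>v. f t x v > 0 \<and> 1 + k * f t x v > 0"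
    and "fokker_planck_solution k \<Omega> T f"
    and "dissipative \<Omega> T f"
    and "standing_assumptions k \<Omega> T f"
    and "\<forall>t\<in>T. entropy_flow k \<Omega> (f t) \<le> 0"
  shows "\<forall>t\<in>T. \<exists>D. ((\<lambda>s. G_tilde k \<Omega> (f s)) has_real_derivative D) (at t within T) \<and> D \<le> 0"
proof
  fix t
  assume t: "t \<in> T"
  let ?E = "\<lambda>s. phase_int \<Omega> (\<lambda>x v. (norm v)\<^sup>2 / 2 * f s x v)"
  let ?P = "\<lambda>s. phase_int \<Omega> (\<lambda>x v. Phi k (f s x v))"
  let ?D = "phase_int \<Omega> (time_deriv T (\<lambda>t x v. (norm v)\<^sup>2 / 2 * f t x v) t)
      + phase_int \<Omega> (time_deriv T (\<lambda>t x v. Phi k (f t x v)) t)"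
  \<comment> \<open>\<open>t\<close> is not an isolated point of \<open>T\<close>, so that derivatives within \<open>T\<close> are unique.\<close>
  have "connected T"
    using assms(7) is_interval_connected by blast
  moreover have "T \<noteq> {x}" for x
    using assms(8) by auto
  ultimately have nontriv: "at t within T \<noteq> bot"
    using connected_imp_perfect[of T t] t trivial_limit_within by blast
  have pos: "0 < f t x v \<and> 0 < 1 + k * f t x v" if "x \<in> \<Omega>" for x v
    using assms(10) t that by blast
  have diff: "(\<lambda>s. f t x (v + s *\<^sub>R b)) differentiable at 0" if "x \<in> \<Omega>" for x v b
  proof -
    have "(\<lambda>(y, u). f t y u) differentiable at (x, v + 0 *\<^sub>R b)"
      using assms(9) t that by (simp add: C01_def)
    moreover have "(\<lambda>s. (x, v + s *\<^sub>R b)) differentiable at (0::real)"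
      by (auto simp: differentiable_def intro!: exI derivative_eq_intros)
    ultimately show ?thesis
      using differentiable_chain_at[of "\<lambda>s. (x, v + s *\<^sub>R b)" 0 "\<lambda>(y, u). f t y u"]
      by (simp add: o_def)
  qed
  have diff2: "(\<lambda>s. partial b (f t x) (v + s *\<^sub>R b)) differentiable at 0" if "x \<in> \<Omega>" "b \<in> Basis" for x v b
    using assms(11) t that by (auto simp: fokker_planck_solution_def)
  have lim: "((\<lambda>s. (ln (f t x (v + s *\<^sub>R b) / (1 + k * f t x (v + s *\<^sub>R b))) + 1 + (norm (v + s *\<^sub>R b))\<^sup>2 / 2)
      * (velocity_flux k (f t) x (v + s *\<^sub>R b) \<bullet> b)) \<longlongrightarrow> 0) at_infinity" if "x \<in> \<Omega>" "b \<in> Basis" for x v b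
    using assms(13) t that by (auto simp: standing_assumptions_def no_terms_at_infinity_def)
  have deriv: "((\<lambda>s. ?E s + ?P s) has_real_derivative ?D) (at t within T)"
    using assms(13) t
    by (intro DERIV_add) (simp_all add: standing_assumptions_def differentiable_under_integral_def)
  have "((\<lambda>s. C_tilde k \<Omega> + (?E s + ?P s)) has_real_derivative 0 + ?D) (at t within T)"
    by (intro DERIV_add DERIV_const deriv)
  moreover have "C_tilde k \<Omega> + (?E s + ?P s) = G_tilde k \<Omega> (f s)" if "s \<in> T" for s
    using assms(13) that by (simp add: G_tilde_def standing_assumptions_def free_energy_eq)
  ultimately have "((\<lambda>s. G_tilde k \<Omega> (f s)) has_real_derivative ?D) (at t within T)"
    using has_field_derivative_transform_within[of _ _ _ _ 1, OF _ zero_less_one t] by simp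
  moreover have "?D \<le> 0"
  proof -
    have "(\<Sum>b\<in>Basis. phase_int \<Omega> (\<lambda>x v. (ln (f t x v / (1 + k * f t x v)) + 1 + (norm v)\<^sup>2 / 2)
        * partial b (\<lambda>u. velocity_flux k (f t) x u \<bullet> b) v)) \<le> 0"
      using pos diff diff2 lim
      by (intro sum_nonpos phase_int_nonpos velocity_flux_integral_nonpos) blast+
    moreover have "0 \<le> energy_flux \<Omega> (f t)" "entropy_flow k \<Omega> (f t) \<le> 0"
      using assms(12,14) t by (auto simp: dissipative_def)
    moreover have "k \<noteq> 0"
      using assms(1) by auto
    ultimately show ?thesis
      using lyapunov_time_deriv_eq[OF _ t nontriv pos diff assms(11) assms(13)] by simp
  qed
  ultimately show "\<exists>D. ((\<lambda>s. G_tilde k \<Omega> (f s)) has_real_derivative D) (at t within T) \<and> D \<le> 0"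
    by blast
qed

end
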